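(* Let $n,N>0$ be integers. If $n\le N$ then $\alpha_3(n,N)\le \overline{\alpha}(n,N)$. If $N\ge 2n-1$, then $\alpha_3(n,N)=\overline{\alpha}(n,N)$.
   Context: $[n]=\{1,\dots,n\}$. A line in $[n]^2\times[N]$ is a set obtained by fixing two of the three coordinates and letting the remaining one vary over its whole range. A linjection $f:[n]^2\times[N]\to\{0,1\}$ (with $N\ge n$) is a function such that for every $(x,y)\in[n]^2$ there is exactly one $b\in[N]$ with $f(x,y,b)=1$, and every line contains at most one point at which $f=1$. (Equivalently, $f$ is encoded by an $n\times n$ matrix $A$ with entries in $[N]$, $A(x,y)=b\iff f(x,y,b)=1$, with no repeated value in any row or column.) In $X_1\times X_2\times X_3=[n]\times[n]\times[N]$, a cylinder in dimension $i$ is a subset closed under arbitrary changes of the $i$-th coordinate, and a cylinder intersection is a set $T_1\cap T_2\cap T_3$ with $T_i$ a cylinder in dimension $i$. $\alpha_3(f)$ is the largest cardinality of a cylinder intersection contained in $f^{-1}(1)$, and $\alpha_3(n,N)=\max_f \alpha_3(f)$ over all linjections $f:[n]^2\times[N]\to\{0,1\}$. For a subgraph $G$ of the complete tripartite graph $K_{n,n,N}$, $\overline{\alpha}(G)$ is the largest cardinality of a family of pairwise edge-disjoint triangles in $G$ such that the graph formed by the union of the triangles in the family contains no triangle other than those of the family. $\overline{\alpha}(n,N)=\max_G\overline{\alpha}(G)$ over all subgraphs $G$ of $K_{n,n,N}$. *)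

theory Defs
  imports "HOL-Library.FuncSet"
begin

type_synonym point = "nat \<times> nat \<times> nat"

definition box :: "nat \<Rightarrow> nat \<Rightarrow> point set" where
  "box n N = {1..n} \<times> {1..n} \<times> {1..N}"

definition lines :: "nat \<Rightarrow> nat \<Rightarrow> point set set" where
  "lines n N =
     {{1..n} \<times> {y} \<times> {b} | y b. y \<in> {1..n} \<and> b \<in> {1..N}} \<union>
     {{x} \<times> {1..n} \<times> {b} | x b. x \<in> {1..n} \<and> b \<in> {1..N}} \<union>
     {{x} \<times> {y} \<times> {1..N} | x y. x \<in> {1..n} \<and> y \<in> {1..n}}"

definition linjection :: "nat \<Rightarrow> nat \<Rightarrow> (point \<Rightarrow> nat) \<Rightarrow> bool" where
  "linjection n N f \<longleftrightarrow>
     n \<le> N \<and>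
     f \<in> box n N \<rightarrow>\<^sub>E {0, 1} \<and>
     (\<forall>x \<in> {1..n}. \<forall>y \<in> {1..n}. \<exists>!b. b \<in> {1..N} \<and> f (x, y, b) = 1) \<and>
     (\<forall>L \<in> lines n N. card {p \<in> L. f p = 1} \<le> 1)"

definition cylinder1 :: "nat \<Rightarrow> nat \<Rightarrow> point set \<Rightarrow> bool" where
  "cylinder1 n N T \<longleftrightarrow> T \<subseteq> box n N \<and>
     (\<forall>x y b. \<forall>x' \<in> {1..n}. (x, y, b) \<in> T \<longrightarrow> (x', y, b) \<in> T)"

definition cylinder2 :: "nat \<Rightarrow> nat \<Rightarrow> point set \<Rightarrow> bool" where
  "cylinder2 n N T \<longleftrightarrow> T \<subseteq> box n N \<and>
     (\<forall>x y b. \<forall>y' \<in> {1..n}. (x, y, b) \<in> T \<longrightarrow> (x, y', b) \<in> T)"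

definition cylinder3 :: "nat \<Rightarrow> nat \<Rightarrow> point set \<Rightarrow> bool" where
  "cylinder3 n N T \<longleftrightarrow> T \<subseteq> box n N \<and>
     (\<forall>x y b. \<forall>b' \<in> {1..N}. (x, y, b) \<in> T \<longrightarrow> (x, y, b') \<in> T)"

definition cylinder_intersection :: "nat \<Rightarrow> nat \<Rightarrow> point set \<Rightarrow> bool" where
  "cylinder_intersection n N C \<longleftrightarrow>
     (\<exists>T1 T2 T3. cylinder1 n N T1 \<and> cylinder2 n N T2 \<and> cylinder3 n N T3 \<and>
        C = T1 \<inter> T2 \<inter> T3)"

definition alpha3_fun :: "nat \<Rightarrow> nat \<Rightarrow> (point \<Rightarrow> nat) \<Rightarrow> nat" where
  "alpha3_fun n N f =
     Max {card C | C. cylinder_intersection n N C \<and> C \<subseteq> {p \<in> box n N. f p = 1}}"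

text \<open>Linjections exist exactly when \<open>n \<le> N\<close>; for \<open>N < n\<close> the following maximum is taken over
  the empty set and is meaningless.\<close>

definition alpha3 :: "nat \<Rightarrow> nat \<Rightarrow> nat" where
  "alpha3 n N = Max {alpha3_fun n N f | f. linjection n N f}"

text \<open>A graph is a pair of a vertex set and a set of edges, each edge being a two-element set of
  vertices.\<close>

type_synonym 'a graph = "'a set \<times> 'a set set"

definition graph :: "'a graph \<Rightarrow> bool" where
  "graph G \<longleftrightarrow> (\<forall>e \<in> snd G. e \<subseteq> fst G \<and> card e = 2)"

definition subgraph :: "'a graph \<Rightarrow> 'a graph \<Rightarrow> bool" where
  "subgraph H G \<longleftrightarrow> graph H \<and> fst H \<subseteq> fst G \<and> snd H \<subseteq> snd G"

text \<open>A vertex is a pair consisting of the number of its part and its index within that part.\<close>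

definition tripartite_vertices :: "nat \<Rightarrow> nat \<Rightarrow> nat \<Rightarrow> (nat \<times> nat) set" where
  "tripartite_vertices a b c = {1} \<times> {1..a} \<union> {2} \<times> {1..b} \<union> {3} \<times> {1..c}"

definition complete_tripartite :: "nat \<Rightarrow> nat \<Rightarrow> nat \<Rightarrow> (nat \<times> nat) graph" where
  "complete_tripartite a b c =
     (tripartite_vertices a b c,
      {{u, v} | u v. u \<in> tripartite_vertices a b c \<and> v \<in> tripartite_vertices a b c \<and>
         fst u \<noteq> fst v})"

text \<open>Triangles are represented by their vertex sets.\<close>

definition triangle_edges :: "'a set \<Rightarrow> 'a set set" where
  "triangle_edges T = {{u, v} | u v. u \<in> T \<and> v \<in> T \<and> u \<noteq> v}"

definition triangles :: "'a graph \<Rightarrow> 'a set set" where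
  "triangles G = {T. T \<subseteq> fst G \<and> card T = 3 \<and> triangle_edges T \<subseteq> snd G}"

definition triangle_union :: "'a set set \<Rightarrow> 'a graph" where
  "triangle_union F = (\<Union>F, \<Union>(triangle_edges ` F))"

definition isolated_triangle_family :: "'a graph \<Rightarrow> 'a set set \<Rightarrow> bool" where
  "isolated_triangle_family G F \<longleftrightarrow>
     F \<subseteq> triangles G \<and>
     (\<forall>S \<in> F. \<forall>T \<in> F. S \<noteq> T \<longrightarrow> triangle_edges S \<inter> triangle_edges T = {}) \<and>
     triangles (triangle_union F) \<subseteq> F"

definition alpha_bar_graph :: "'a graph \<Rightarrow> nat" where
  "alpha_bar_graph G = Max {card F | F. isolated_triangle_family G F}"

definition alpha_bar :: "nat \<Rightarrow> nat \<Rightarrow> nat" where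
  "alpha_bar n N = Max {alpha_bar_graph G | G. subgraph G (complete_tripartite n n N)}"

end

theory Submission
  imports Defs
begin

text \<open>A point \<open>(x, y, b)\<close> is the same thing as a triangle of \<open>K\<^bsub>n,n,N\<^esub>\<close>. Under this correspondence
  edge-disjointness says that no two points lie on a common line, and the absence of further
  triangles in the union says that the point set is closed under the star condition characterising
  cylinder intersections. Both quantities thus maximise the size of a star-closed set
  with at most one point on each line; \<open>\<alpha>\<^sub>3\<close> requires in addition that the set extends to a linjection. For \<open>N \<ge> 2n - 1\<close> this is automatic:
  an empty cell sees at most \<open>2n - 2\<close> values in its row and column, so it can be filled.\<close>

section \<open>Partial Latin sets, star-closed sets and cylinder intersections\<close>

definition partial_latin :: "point set \<Rightarrow> bool" where
  "partial_latin P \<longleftrightarrow>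
     (\<forall>x y b b'. (x, y, b) \<in> P \<longrightarrow> (x, y, b') \<in> P \<longrightarrow> b = b') \<and>
     (\<forall>x y y' b. (x, y, b) \<in> P \<longrightarrow> (x, y', b) \<in> P \<longrightarrow> y = y') \<and>
     (\<forall>x x' y b. (x, y, b) \<in> P \<longrightarrow> (x', y, b) \<in> P \<longrightarrow> x = x')"

text \<open>The three given points form a star with centre \<open>(x, y, b)\<close>: each lies on a
  different one of the three lines through the centre.\<close>

definition star_closed :: "point set \<Rightarrow> bool" where
  "star_closed P \<longleftrightarrow>
     (\<forall>x y b x' y' b'. (x', y, b) \<in> P \<longrightarrow> (x, y', b) \<in> P \<longrightarrow> (x, y, b') \<in> P \<longrightarrow> (x, y, b) \<in> P)"

lemma finite_box: "finite (box n N)"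
  by (simp add: box_def)

lemma partial_latin_subset: "partial_latin P \<Longrightarrow> Q \<subseteq> P \<Longrightarrow> partial_latin Q"
  unfolding partial_latin_def by blast

lemma cylinder_intersection_subset: "cylinder_intersection n N C \<Longrightarrow> C \<subseteq> box n N"
  by (auto simp: cylinder_intersection_def cylinder1_def)

text \<open>Each point of a star puts the centre into one of the three cylinders. Conversely, a
  star-closed set is the intersection of the smallest cylinders containing it, one per
  dimension.\<close>

lemma cylinder_intersection_iff:
  assumes "P \<subseteq> box n N"
  shows "cylinder_intersection n N P \<longleftrightarrow> star_closed P"
proof
  assume "cylinder_intersection n N P"
  then obtain T1 T2 T3 where T: "cylinder1 n N T1" "cylinder2 n N T2" "cylinder3 n N T3"
    and P: "P = T1 \<inter> T2 \<inter> T3"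
    by (auto simp: cylinder_intersection_def)
  show "star_closed P"
    unfolding star_closed_def
  proof (intro allI impI)
    fix x y b x' y' b'
    assume *: "(x', y, b) \<in> P" "(x, y', b) \<in> P" "(x, y, b') \<in> P"
    \<comment> \<open>Cylinders are closed only under changes within the coordinate ranges, so the
      centre must first be seen to lie in the box.\<close>
    then have "x \<in> {1..n}" "y \<in> {1..n}" "b \<in> {1..N}"
      using assms by (auto simp: box_def)
    with * T show "(x, y, b) \<in> P"
      unfolding P cylinder1_def cylinder2_def cylinder3_def by blast
  qed
next
  assume cl: "star_closed P"
  \<comment> \<open>\<open>T1\<close>, \<open>T2\<close>, \<open>T3\<close> are the cylinders
    generated by \<open>P\<close>: in each direction, the union of all lines that meet
    \<open>P\<close>. A point common to all three is the centre of a star in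
    \<open>P\<close>.\<close>
  define T1 where "T1 = {(x, y, b). x \<in> {1..n} \<and> (\<exists>x'. (x', y, b) \<in> P)}"
  define T2 where "T2 = {(x, y, b). y \<in> {1..n} \<and> (\<exists>y'. (x, y', b) \<in> P)}"
  define T3 where "T3 = {(x, y, b). b \<in> {1..N} \<and> (\<exists>b'. (x, y, b') \<in> P)}"
  have "cylinder1 n N T1" "cylinder2 n N T2" "cylinder3 n N T3"
    using assms
    by (auto simp: cylinder1_def cylinder2_def cylinder3_def T1_def T2_def T3_def box_def)
  moreover have "P = T1 \<inter> T2 \<inter> T3"
  proof
    show "P \<subseteq> T1 \<inter> T2 \<inter> T3"
      using assms by (fastforce simp: T1_def T2_def T3_def box_def)
    show "T1 \<inter> T2 \<inter> T3 \<subseteq> P"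
      using cl unfolding star_closed_def T1_def T2_def T3_def by blast
  qed
  ultimately show "cylinder_intersection n N P"
    unfolding cylinder_intersection_def by blast
qed

subsection \<open>Points as triangles\<close>

fun tri :: "point \<Rightarrow> (nat \<times> nat) set" where
  "tri (x, y, b) = {(1, x), (2, y), (3, b)}"

lemma mem_tri:
  "(1, i) \<in> tri (x, y, b) \<longleftrightarrow> i = x"
  "(2, i) \<in> tri (x, y, b) \<longleftrightarrow> i = y"
  "(3, i) \<in> tri (x, y, b) \<longleftrightarrow> i = b"
  by auto

text \<open>The part numbers make every coordinate recoverable from the vertex set.\<close>

lemma inj_tri: "inj tri"
proof (rule injI)
  fix p q assume "tri p = tri q"
  then show "p = q"
    by (cases p; cases q) (metis mem_tri)
qed

lemma triangle_edges_iff: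
  "u \<noteq> v \<Longrightarrow> {u, v} \<in> triangle_edges T \<longleftrightarrow> u \<in> T \<and> v \<in> T"
  by (auto simp: triangle_edges_def doubleton_eq_iff)

lemma triangle_edges_tri:
  "triangle_edges (tri (x, y, b)) = {{(1, x), (2, y)}, {(1, x), (3, b)}, {(2, y), (3, b)}}"
proof
  show "triangle_edges (tri (x, y, b)) \<subseteq> {{(1, x), (2, y)}, {(1, x), (3, b)}, {(2, y), (3, b)}}"
    by (auto simp: triangle_edges_def doubleton_eq_iff)
  show "{{(1, x), (2, y)}, {(1, x), (3, b)}, {(2, y), (3, b)}} \<subseteq> triangle_edges (tri (x, y, b))"
    by (simp add: triangle_edges_iff)
qed

lemma complete_tripartite_edge_iff:
  "{u, v} \<in> snd (complete_tripartite a b c) \<longleftrightarrow>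
     u \<in> tripartite_vertices a b c \<and> v \<in> tripartite_vertices a b c \<and> fst u \<noteq> fst v"
proof
  assume "{u, v} \<in> snd (complete_tripartite a b c)"
  then obtain u' v' where "{u, v} = {u', v'}" "u' \<in> tripartite_vertices a b c"
    "v' \<in> tripartite_vertices a b c" "fst u' \<noteq> fst v'"
    unfolding complete_tripartite_def snd_conv by blast
  then show "u \<in> tripartite_vertices a b c \<and> v \<in> tripartite_vertices a b c \<and> fst u \<noteq> fst v"
    by (metis doubleton_eq_iff)
next
  assume "u \<in> tripartite_vertices a b c \<and> v \<in> tripartite_vertices a b c \<and> fst u \<noteq> fst v"
  then show "{u, v} \<in> snd (complete_tripartite a b c)"
    unfolding complete_tripartite_def snd_conv by blast
qed

lemma card_tri: "card (tri p) = 3"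
  by (cases p) simp

lemma tri_subset_vertices: "p \<in> box n N \<Longrightarrow> tri p \<subseteq> tripartite_vertices n n N"
  by (cases p) (auto simp: box_def tripartite_vertices_def)

lemma tri_edges_subset:
  assumes "p \<in> box n N"
  shows "triangle_edges (tri p) \<subseteq> snd (complete_tripartite n n N)"
proof
  fix e assume "e \<in> triangle_edges (tri p)"
  then obtain u v where "e = {u, v}" "u \<in> tri p" "v \<in> tri p" "u \<noteq> v"
    unfolding triangle_edges_def by blast
  moreover from this have "fst u \<noteq> fst v"
    by (cases p) auto
  ultimately show "e \<in> snd (complete_tripartite n n N)"
    using tri_subset_vertices[OF assms] by (auto simp: complete_tripartite_edge_iff)
qed

text \<open>Vertices in the same part are not adjacent, so the three vertices of a triangle lie in
  three different parts, one in each.\<close>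

lemma triangle_eq_tri:
  assumes "T \<in> triangles G" "subgraph G (complete_tripartite n n N)"
  obtains p where "p \<in> box n N" "T = tri p"
proof -
  have T: "T \<subseteq> tripartite_vertices n n N" "card T = 3"
    "triangle_edges T \<subseteq> snd (complete_tripartite n n N)"
    using assms by (auto simp: triangles_def subgraph_def complete_tripartite_def)
  have "inj_on fst T"
  proof (rule inj_onI, rule ccontr)
    fix u v assume uv: "u \<in> T" "v \<in> T" "fst u = fst v" "u \<noteq> v"
    then have "{u, v} \<in> snd (complete_tripartite n n N)"
      using subsetD[OF T(3)] triangle_edges_iff[of u v T] by simp
    then show False
      using uv by (simp add: complete_tripartite_edge_iff)
  qed
  then have "card (fst ` T) = 3"
    using T(2) card_image by metis
  moreover have "fst ` T \<subseteq> {1, 2, 3}"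
    using T(1) by (auto simp: tripartite_vertices_def)
  ultimately have "fst ` T = {1, 2, 3}"
    using card_subset_eq[of "{1, 2, 3}" "fst ` T"] by simp
  then have "1 \<in> fst ` T" "2 \<in> fst ` T" "3 \<in> fst ` T"
    by simp_all
  then obtain x y b where xyb: "(1, x) \<in> T" "(2, y) \<in> T" "(3, b) \<in> T"
    unfolding image_iff by (metis prod.collapse)
  \<comment> \<open>Infinite sets have \<open>card\<close> 0, so cardinality 3 forces
    finiteness.\<close>
  have "finite T" using T(2) card.infinite by fastforce
  moreover have "tri (x, y, b) \<subseteq> T" using xyb by simp
  ultimately have "tri (x, y, b) = T"
    using T(2) card_tri[of "(x, y, b)"] card_subset_eq[of T "tri (x, y, b)"] by metis
  moreover have "(x, y, b) \<in> box n N"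
    using xyb T(1) by (auto simp: tripartite_vertices_def box_def)
  ultimately show thesis using that by blast
qed

text \<open>The edges of \<open>tri (x, y, b)\<close> record the pairs (x, y), (x, b) and (y, b),
  that is, the three lines through the point. Sharing an edge therefore means lying on a common
  line.\<close>

lemma edge_disjoint_iff:
  "(\<forall>S \<in> tri ` P. \<forall>T \<in> tri ` P. S \<noteq> T \<longrightarrow> triangle_edges S \<inter> triangle_edges T = {})
     \<longleftrightarrow> partial_latin P"
proof
  assume L: "\<forall>S \<in> tri ` P. \<forall>T \<in> tri ` P. S \<noteq> T \<longrightarrow> triangle_edges S \<inter> triangle_edges T = {}"
  have D: "p = q" if "p \<in> P" "q \<in> P" "e \<in> triangle_edges (tri p)" "e \<in> triangle_edges (tri q)"
    for p q e
    using L that inj_tri[THEN injD, of p q] by blast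
  show "partial_latin P"
    unfolding partial_latin_def
  proof (intro conjI allI impI)
    fix x y b b' assume "(x, y, b) \<in> P" "(x, y, b') \<in> P"
    from D[OF this, of "{(1, x), (2, y)}"] show "b = b'"
      by (simp add: triangle_edges_tri del: tri.simps)
  next
    fix x y y' b assume "(x, y, b) \<in> P" "(x, y', b) \<in> P"
    from D[OF this, of "{(1, x), (3, b)}"] show "y = y'"
      by (simp add: triangle_edges_tri del: tri.simps)
  next
    fix x x' y b assume "(x, y, b) \<in> P" "(x', y, b) \<in> P"
    from D[OF this, of "{(2, y), (3, b)}"] show "x = x'"
      by (simp add: triangle_edges_tri del: tri.simps)
  qed
next
  assume P: "partial_latin P"
  have D: "p = q" if "p \<in> P" "q \<in> P" "e \<in> triangle_edges (tri p)" "e \<in> triangle_edges (tri q)"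
    for p q e
  proof -
    obtain x y b x' y' b' where pq: "p = (x, y, b)" "q = (x', y', b')"
      by (metis prod.collapse)
    \<comment> \<open>Edges between different pairs of parts are never equal, so a shared edge fixes
      the same two coordinates in both points.\<close>
    have "x = x' \<and> y = y' \<or> x = x' \<and> b = b' \<or> y = y' \<and> b = b'"
      using that(3,4) unfolding pq triangle_edges_tri
      by (elim insertE emptyE) (simp_all add: doubleton_eq_iff)
    then show ?thesis
      using P that(1,2) unfolding partial_latin_def pq by metis
  qed
  show "\<forall>S \<in> tri ` P. \<forall>T \<in> tri ` P. S \<noteq> T \<longrightarrow> triangle_edges S \<inter> triangle_edges T = {}"
  proof (intro ballI impI, elim imageE)
    fix S T p q assume "S \<noteq> T" "p \<in> P" "q \<in> P" "S = tri p" "T = tri q"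
    then show "triangle_edges S \<inter> triangle_edges T = {}"
      using D[of p q] by (metis IntE equals0I)
  qed
qed

text \<open>The union contains \<open>tri (x, y, b)\<close> exactly when each of its edges belongs
  to some triangle of the family, that is, when \<open>P\<close> meets all three lines through (x,
  y, b).\<close>

lemma no_further_triangles_iff:
  assumes "P \<subseteq> box n N"
  shows "triangles (triangle_union (tri ` P)) \<subseteq> tri ` P \<longleftrightarrow> star_closed P"
proof
  assume L: "triangles (triangle_union (tri ` P)) \<subseteq> tri ` P"
  show "star_closed P"
    unfolding star_closed_def
  proof (intro allI impI)
    fix x y b x' y' b'
    assume *: "(x', y, b) \<in> P" "(x, y', b) \<in> P" "(x, y, b') \<in> P"
    have "(1, x) \<in> tri (x, y, b')" "(2, y) \<in> tri (x, y, b')" "(3, b) \<in> tri (x, y', b)"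
      by simp_all
    then have "(1, x) \<in> \<Union>(tri ` P)" "(2, y) \<in> \<Union>(tri ` P)" "(3, b) \<in> \<Union>(tri ` P)"
      using * by (meson UN_I)+
    then have "tri (x, y, b) \<subseteq> \<Union>(tri ` P)"
      by simp
    moreover have "triangle_edges (tri (x, y, b)) \<subseteq> \<Union>(triangle_edges ` tri ` P)"
    proof -
      \<comment> \<open>Each point of the star contributes the edge on the two coordinates it shares
        with the centre.\<close>
      have "{(2, y), (3, b)} \<in> triangle_edges (tri (x', y, b))"
        "{(1, x), (3, b)} \<in> triangle_edges (tri (x, y', b))"
        "{(1, x), (2, y)} \<in> triangle_edges (tri (x, y, b'))"
        by (simp_all add: triangle_edges_iff)
      then show ?thesis
        unfolding triangle_edges_tri[of x y b] insert_subset
        using * by (meson UN_I empty_subsetI imageI)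
    qed
    ultimately have "tri (x, y, b) \<in> triangles (triangle_union (tri ` P))"
      by (simp add: triangles_def triangle_union_def card_tri del: tri.simps)
    then show "(x, y, b) \<in> P"
      using L inj_tri by (meson inj_image_mem_iff subsetD)
  qed
next
  assume cl: "star_closed P"
  \<comment> \<open>Since \<open>P\<close> lies in the box, the union sits inside the complete
    tripartite graph, so every triangle in it has the form \<open>tri p\<close>.\<close>
  have sub: "subgraph (triangle_union (tri ` P)) (complete_tripartite n n N)"
    unfolding subgraph_def
  proof (intro conjI)
    show "graph (triangle_union (tri ` P))"
      unfolding graph_def triangle_union_def fst_conv snd_conv
    proof
      fix e assume "e \<in> \<Union>(triangle_edges ` tri ` P)"
      then obtain T where T: "T \<in> tri ` P" "e \<in> triangle_edges T"
        by (meson UN_E)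
      then obtain u v where "u \<in> T" "v \<in> T" "u \<noteq> v" "e = {u, v}"
        unfolding triangle_edges_def by blast
      then have "e \<subseteq> T" "card e = 2"
        by simp_all
      with T(1) show "e \<subseteq> \<Union>(tri ` P) \<and> card e = 2"
        by (meson Sup_upper order_trans)
    qed
    show "fst (triangle_union (tri ` P)) \<subseteq> fst (complete_tripartite n n N)"
      using assms tri_subset_vertices[of _ n N]
      unfolding triangle_union_def complete_tripartite_def fst_conv by blast
    show "snd (triangle_union (tri ` P)) \<subseteq> snd (complete_tripartite n n N)"
      using assms tri_edges_subset[of _ n N] unfolding triangle_union_def snd_conv by blast
  qed
  show "triangles (triangle_union (tri ` P)) \<subseteq> tri ` P"
  proof
    fix T assume T: "T \<in> triangles (triangle_union (tri ` P))"
    then obtain x y b where Teq: "T = tri (x, y, b)"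
      using triangle_eq_tri[OF T sub] by (metis prod.collapse)
    \<comment> \<open>Every edge of a triangle in the union comes from a member of the family;
      applied to the three edges this yields the three points of a star.\<close>
    have edge: "\<exists>p\<in>P. u \<in> tri p \<and> v \<in> tri p" if "u \<in> T" "v \<in> T" "u \<noteq> v" for u v
    proof -
      have "{u, v} \<in> \<Union>(triangle_edges ` tri ` P)"
        using T that triangle_edges_iff[of u v T] by (auto simp: triangles_def triangle_union_def)
      then show ?thesis
        using triangle_edges_iff[OF that(3)] by auto
    qed
    have "\<exists>x'. (x', y, b) \<in> P"
      using edge[of "(2, y)" "(3, b)"] unfolding Teq by fastforce
    moreover have "\<exists>y'. (x, y', b) \<in> P"
      using edge[of "(1, x)" "(3, b)"] unfolding Teq by fastforce
    moreover have "\<exists>b'. (x, y, b') \<in> P"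
      using edge[of "(1, x)" "(2, y)"] unfolding Teq by fastforce
    ultimately show "T \<in> tri ` P"
      using cl unfolding Teq star_closed_def by blast
  qed
qed

text \<open>The condition on further triangles concerns only the union of the family, not the host
  graph. Hence the complete tripartite graph can serve as host for every such
  \<open>P\<close>.\<close>

lemma isolated_triangle_family_tri:
  assumes "P \<subseteq> box n N" "partial_latin P" "star_closed P"
  shows "isolated_triangle_family (complete_tripartite n n N) (tri ` P)"
proof -
  have "tri ` P \<subseteq> triangles (complete_tripartite n n N)"
  proof
    fix T assume "T \<in> tri ` P"
    then obtain p where "T = tri p" "p \<in> box n N" using assms(1) by blast
    then show "T \<in> triangles (complete_tripartite n n N)"
      using tri_subset_vertices tri_edges_subset[of p n N]
      by (simp add: triangles_def card_tri complete_tripartite_def)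
  qed
  then show ?thesis
    using assms edge_disjoint_iff[of P] no_further_triangles_iff[of P n N]
    by (simp add: isolated_triangle_family_def)
qed

text \<open>The way back from triangles to points, for an arbitrary host subgraph.\<close>

lemma isolated_triangle_familyE:
  assumes "isolated_triangle_family G F" "subgraph G (complete_tripartite n n N)"
  obtains P where "P \<subseteq> box n N" "partial_latin P" "star_closed P" "F = tri ` P"
proof -
  define P where "P = {p \<in> box n N. tri p \<in> F}"
  have sub: "P \<subseteq> box n N" by (auto simp: P_def)
  have "F = tri ` P"
  proof
    show "F \<subseteq> tri ` P"
    proof
      fix T assume T: "T \<in> F"
      then have "T \<in> triangles G"
        using assms(1) by (meson isolated_triangle_family_def subsetD)
      then obtain p where "p \<in> box n N" "T = tri p"
        using triangle_eq_tri[OF _ assms(2)] by metis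
      with T have "p \<in> P" by (simp add: P_def)
      with \<open>T = tri p\<close> show "T \<in> tri ` P" by (rule image_eqI)
    qed
    show "tri ` P \<subseteq> F"
      unfolding P_def by blast
  qed
  moreover have "partial_latin P"
    using assms(1) unfolding \<open>F = tri ` P\<close> isolated_triangle_family_def edge_disjoint_iff by meson
  moreover have "star_closed P"
    using assms(1) no_further_triangles_iff[OF sub]
    unfolding \<open>F = tri ` P\<close> isolated_triangle_family_def by meson
  ultimately show thesis
    using that sub by metis
qed

subsection \<open>The maxima\<close>

lemma card_tri_image: "card (tri ` P) = card P"
  using inj_tri by (meson card_image inj_on_subset subset_UNIV)

lemma finite_triangle_families:
  assumes "subgraph G (complete_tripartite n n N)"
  shows "finite {card F | F. isolated_triangle_family G F}"
proof -
  have "finite (fst G)"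
    using assms by (auto simp: subgraph_def complete_tripartite_def tripartite_vertices_def
        intro: finite_subset)
  then have "finite (triangles G)"
    by (auto simp: triangles_def)
  then have "finite {F. isolated_triangle_family G F}"
    by (auto simp: isolated_triangle_family_def intro: finite_subset[of _ "Pow (triangles G)"])
  then show ?thesis
    by (simp add: setcompr_eq_image)
qed

text \<open>Ensures that the set of family sizes is nonempty, so that its maximum is
  attained.\<close>

lemma isolated_triangle_family_empty: "isolated_triangle_family G {}"
  by (auto simp: isolated_triangle_family_def triangles_def triangle_union_def)

text \<open>A subgraph may choose both its vertices and its edges; each choice ranges over a finite
  power set.\<close>

lemma finite_alpha_bar_graphs:
  "finite {alpha_bar_graph G | G. subgraph G (complete_tripartite n n N)}"
proof -
  let ?V = "tripartite_vertices n n N"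
  have "finite ?V" by (simp add: tripartite_vertices_def)
  moreover have "snd G \<subseteq> Pow ?V" if "subgraph G (complete_tripartite n n N)" for G
    using that by (auto simp: subgraph_def graph_def complete_tripartite_def)
  moreover have "fst G \<subseteq> ?V" if "subgraph G (complete_tripartite n n N)" for G
    using that by (simp add: subgraph_def complete_tripartite_def)
  ultimately have "{G. subgraph G (complete_tripartite n n N)} \<subseteq> Pow ?V \<times> Pow (Pow ?V)"
    by (simp add: subset_iff mem_Times_iff)
  then have "finite {G. subgraph G (complete_tripartite n n N)}"
    by (rule finite_subset) (simp add: \<open>finite ?V\<close>)
  then show ?thesis
    unfolding setcompr_eq_image by (rule finite_imageI)
qed

lemma subgraph_complete: "subgraph (complete_tripartite n n N) (complete_tripartite n n N)"
proof -
  have "e \<subseteq> tripartite_vertices n n N \<and> card e = 2"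
    if e: "e \<in> snd (complete_tripartite n n N)" for e
  proof -
    obtain u v where "e = {u, v}" "u \<in> tripartite_vertices n n N" "v \<in> tripartite_vertices n n N"
      "fst u \<noteq> fst v"
      using e unfolding complete_tripartite_def snd_conv by blast
    then show ?thesis by (auto simp: card_insert_if)
  qed
  then show ?thesis
    by (simp add: subgraph_def graph_def complete_tripartite_def)
qed

text \<open>Together with \<open>alpha_bar_attained\<close> this replaces graphs by point sets:
  \<open>alpha_bar n N\<close> is the largest size of a star-closed partial Latin set in the
  box.\<close>

lemma alpha_bar_ge:
  assumes "P \<subseteq> box n N" "partial_latin P" "star_closed P"
  shows "card P \<le> alpha_bar n N"
proof -
  have "card P \<le> alpha_bar_graph (complete_tripartite n n N)"
    unfolding alpha_bar_graph_def
    using isolated_triangle_family_tri[OF assms] card_tri_image[of P]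
    by (intro Max_ge finite_triangle_families[OF subgraph_complete]) (auto intro!: exI)
  also have "\<dots> \<le> alpha_bar n N"
    unfolding alpha_bar_def
    using subgraph_complete by (intro Max_ge finite_alpha_bar_graphs) blast
  finally show ?thesis .
qed

lemma alpha_bar_attained:
  obtains P where "P \<subseteq> box n N" "partial_latin P" "star_closed P" "card P = alpha_bar n N"
proof -
  have "alpha_bar n N \<in> {alpha_bar_graph G | G. subgraph G (complete_tripartite n n N)}"
    unfolding alpha_bar_def
    using subgraph_complete by (intro Max_in finite_alpha_bar_graphs) blast
  then obtain G where G: "subgraph G (complete_tripartite n n N)" "alpha_bar n N = alpha_bar_graph G"
    by blast
  have "alpha_bar_graph G \<in> {card F | F. isolated_triangle_family G F}"
    unfolding alpha_bar_graph_def
    using isolated_triangle_family_empty by (intro Max_in finite_triangle_families[OF G(1)]) blast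
  then obtain F where "isolated_triangle_family G F" "alpha_bar_graph G = card F"
    by blast
  with G show thesis
    using that isolated_triangle_familyE by (metis card_tri_image)
qed

lemma finite_cylinder_intersections:
  "finite {card C | C. cylinder_intersection n N C \<and> C \<subseteq> {p \<in> box n N. f p = 1}}"
proof -
  have "{C. cylinder_intersection n N C \<and> C \<subseteq> {p \<in> box n N. f p = 1}} \<subseteq> Pow (box n N)"
    using cylinder_intersection_subset by blast
  then have "finite {C. cylinder_intersection n N C \<and> C \<subseteq> {p \<in> box n N. f p = 1}}"
    by (rule finite_subset) (simp add: finite_box)
  then show ?thesis
    by (simp add: setcompr_eq_image)
qed

text \<open>Linjections are extensional functions on a finite box with values in a two-element set,
  so there are finitely many.\<close>

lemma finite_linjections: "finite {alpha3_fun n N f | f. linjection n N f}"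
proof -
  have "{f. linjection n N f} \<subseteq> box n N \<rightarrow>\<^sub>E {0, 1}"
    unfolding linjection_def by blast
  then have "finite {f. linjection n N f}"
    using finite_PiE[OF finite_box, of n N "\<lambda>_. {0, 1}"] finite_subset by blast
  then show ?thesis
    by (simp add: setcompr_eq_image)
qed

lemma alpha3_ge:
  assumes "linjection n N f" "cylinder_intersection n N C" "C \<subseteq> {p \<in> box n N. f p = 1}"
  shows "card C \<le> alpha3 n N"
proof -
  have "card C \<le> alpha3_fun n N f"
    unfolding alpha3_fun_def
    using assms by (intro Max_ge finite_cylinder_intersections) blast
  also have "\<dots> \<le> alpha3 n N"
    unfolding alpha3_def using assms by (intro Max_ge finite_linjections) blast
  finally show ?thesis .
qed

text \<open>The given linjection \<open>g\<close> only witnesses that the outer maximum is taken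
  over a nonempty set.\<close>

lemma alpha3_attained:
  assumes "linjection n N g"
  obtains f C where "linjection n N f" "cylinder_intersection n N C"
    "C \<subseteq> {p \<in> box n N. f p = 1}" "card C = alpha3 n N"
proof -
  have "{alpha3_fun n N f | f. linjection n N f} \<noteq> {}"
    using assms by blast
  from Max_in[OF finite_linjections this]
  obtain f where f: "linjection n N f" "alpha3 n N = alpha3_fun n N f"
    unfolding alpha3_def[symmetric] mem_Collect_eq by metis
  let ?S = "{card C | C. cylinder_intersection n N C \<and> C \<subseteq> {p \<in> box n N. f p = 1}}"
  \<comment> \<open>The empty set keeps the inner maximum from being taken over the empty
    set.\<close>
  have "cylinder_intersection n N {}"
    using cylinder_intersection_iff[of "{}" n N] by (simp add: star_closed_def)
  then have "card ({} :: point set) \<in> ?S"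
    unfolding mem_Collect_eq by (intro exI[of _ "{}"]) simp
  then have "?S \<noteq> {}"
    by (metis empty_iff)
  from Max_in[OF finite_cylinder_intersections this]
  obtain C where C: "cylinder_intersection n N C" "C \<subseteq> {p \<in> box n N. f p = 1}"
    "alpha3_fun n N f = card C"
    unfolding alpha3_fun_def[symmetric] mem_Collect_eq by metis
  show thesis
    using that[OF f(1) C(1,2)] C(3) f(2) by simp
qed

subsection \<open>Linjections as complete Latin rectangles\<close>

lemma linjection_partial_latin:
  assumes "linjection n N f"
  shows "partial_latin {p \<in> box n N. f p = 1}"
proof -
  have one: "\<forall>L \<in> lines n N. card {p \<in> L. f p = 1} \<le> 1"
    using assms unfolding linjection_def by (elim conjE)
  have D: "p = q" if "L \<in> lines n N" "p \<in> L" "q \<in> L" "f p = 1" "f q = 1" for L p q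
  proof -
    let ?A = "{p \<in> L. f p = 1}"
    \<comment> \<open>The bound on \<open>card\<close> yields uniqueness only for finite sets, as
      infinite sets have \<open>card\<close> 0.\<close>
    have "finite L" using that(1) by (auto simp: lines_def)
    then have fin: "finite ?A" by simp
    have "card ?A \<le> 1"
      using one that(1) by (rule bspec)
    then have "card ?A \<le> Suc 0" by simp
    then have eq: "\<forall>p \<in> ?A. \<forall>q \<in> ?A. p = q"
      by (rule iffD1[OF card_le_Suc0_iff_eq[OF fin]])
    have "p \<in> ?A" "q \<in> ?A" using that by simp_all
    then show ?thesis by (rule bspec[OF bspec[OF eq]])
  qed
  have line1: "{1..n} \<times> {y} \<times> {b} \<in> lines n N" if "y \<in> {1..n}" "b \<in> {1..N}" for y b
    unfolding lines_def
    by (rule UnI1, rule UnI1, rule CollectI, (rule exI)+, rule conjI[OF refl conjI[OF that]])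
  have line2: "{x} \<times> {1..n} \<times> {b} \<in> lines n N" if "x \<in> {1..n}" "b \<in> {1..N}" for x b
    unfolding lines_def
    by (rule UnI1, rule UnI2, rule CollectI, (rule exI)+, rule conjI[OF refl conjI[OF that]])
  have line3: "{x} \<times> {y} \<times> {1..N} \<in> lines n N" if "x \<in> {1..n}" "y \<in> {1..n}" for x y
    unfolding lines_def
    by (rule UnI2, rule CollectI, (rule exI)+, rule conjI[OF refl conjI[OF that]])
  show ?thesis
    unfolding partial_latin_def
  proof (intro conjI allI impI)
    fix x y b b' assume "(x, y, b) \<in> {p \<in> box n N. f p = 1}" "(x, y, b') \<in> {p \<in> box n N. f p = 1}"
    then show "b = b'"
      using D[OF line3, of x y "(x, y, b)" "(x, y, b')"] by (simp add: box_def)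
  next
    fix x y y' b assume "(x, y, b) \<in> {p \<in> box n N. f p = 1}" "(x, y', b) \<in> {p \<in> box n N. f p = 1}"
    then show "y = y'"
      using D[OF line2, of x b "(x, y, b)" "(x, y', b)"] by (simp add: box_def)
  next
    fix x x' y b assume "(x, y, b) \<in> {p \<in> box n N. f p = 1}" "(x', y, b) \<in> {p \<in> box n N. f p = 1}"
    then show "x = x'"
      using D[OF line1, of y b "(x, y, b)" "(x', y, b)"] by (simp add: box_def)
  qed
qed

lemma partial_latin_line:
  assumes "partial_latin P" "L \<in> lines n N" "p \<in> L \<inter> P" "q \<in> L \<inter> P"
  shows "p = q"
proof -
  consider y b where "L = {1..n} \<times> {y} \<times> {b}" | x b where "L = {x} \<times> {1..n} \<times> {b}"
    | x y where "L = {x} \<times> {y} \<times> {1..N}"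
    using assms(2) unfolding lines_def by (elim UnE CollectE exE conjE) metis+
  then show ?thesis
  proof cases
    case 1
    then show ?thesis using assms(1,3,4) unfolding partial_latin_def by (cases p, cases q) simp
  next
    case 2
    then show ?thesis using assms(1,3,4) unfolding partial_latin_def by (cases p, cases q) simp
  next
    case 3
    then show ?thesis using assms(1,3,4) unfolding partial_latin_def by (cases p, cases q) simp
  qed
qed

text \<open>The indicator function of a partial Latin set with no empty cell is a linjection:
  \<open>full\<close> gives existence of a value in each cell, the Latin conditions give uniqueness
  along every line.\<close>

lemma linjection_indicator:
  assumes P: "P \<subseteq> box n N" "partial_latin P" and "n \<le> N"
    and full: "\<And>x y. x \<in> {1..n} \<Longrightarrow> y \<in> {1..n} \<Longrightarrow> \<exists>b. (x, y, b) \<in> P"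
  obtains f where "linjection n N f" "{p \<in> box n N. f p = 1} = P"
proof -
  \<comment> \<open>The restricted abstraction makes \<open>f\<close> extensional, as membership in
    the function space demands.\<close>
  define f :: "point \<Rightarrow> nat" where
    "f = (\<lambda>p \<in> box n N. if p \<in> P then 1 else 0)"
  have f1: "f p = 1 \<longleftrightarrow> p \<in> P" if "p \<in> box n N" for p
    using that by (simp add: f_def)
  have "linjection n N f"
    unfolding linjection_def
  proof (intro conjI ballI)
    show "f \<in> box n N \<rightarrow>\<^sub>E {0, 1}" by (auto simp: f_def)
  next
    fix x y assume xy: "x \<in> {1..n}" "y \<in> {1..n}"
    then obtain b where "(x, y, b) \<in> P" using full by blast
    with P(1) f1 have b: "b \<in> {1..N}" "f (x, y, b) = 1"
      by (auto simp: box_def)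
    have "b' = b" if "b' \<in> {1..N}" "f (x, y, b') = 1" for b'
      using that xy f1[of "(x, y, b')"] \<open>(x, y, b) \<in> P\<close> P(2)
      unfolding partial_latin_def box_def by simp
    with b show "\<exists>!b. b \<in> {1..N} \<and> f (x, y, b) = 1"
      by metis
  next
    fix L assume L: "L \<in> lines n N"
    then have "L \<subseteq> box n N" by (auto simp: lines_def box_def)
    with f1 have eq: "{p \<in> L. f p = 1} = L \<inter> P" by blast
    have "finite (L \<inter> P)"
      using finite_subset[OF P(1) finite_box] by simp
    moreover have "\<forall>p \<in> L \<inter> P. \<forall>q \<in> L \<inter> P. p = q"
      by (intro ballI partial_latin_line[OF P(2) L])
    ultimately have "card (L \<inter> P) \<le> Suc 0"
      by (rule iffD2[OF card_le_Suc0_iff_eq])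
    then show "card {p \<in> L. f p = 1} \<le> 1"
      unfolding eq by simp
  qed fact
  moreover have "{p \<in> box n N. f p = 1} = P"
    using f1 P(1) by blast
  ultimately show thesis using that by blast
qed

section \<open>Existence of linjections\<close>

lemma mod_add_left_inj:
  fixes n x x' y :: nat
  assumes "(x + y) mod n = (x' + y) mod n" "x \<in> {1..n}" "x' \<in> {1..n}"
  shows "x = x'"
proof -
  \<comment> \<open>Two elements of \<open>{1..n}\<close> differ by less than \<open>n\<close>, so a
    difference divisible by \<open>n\<close> is 0. Integers avoid truncated subtraction.\<close>
  have "\<bar>int x - int x'\<bar> < int n" using assms by auto
  moreover have "int (x + y) mod int n = int (x' + y) mod int n"
    using assms(1) by (metis of_nat_mod)
  then have "int n dvd int x - int x'"
    by (simp add: mod_eq_dvd_iff)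
  ultimately show ?thesis
    using zdvd_imp_le[of "int n" "\<bar>int x - int x'\<bar>"] by auto
qed

lemma linjection_exists:
  assumes "n \<le> N"
  obtains f where "linjection n N f"
proof -
  \<comment> \<open>The cyclic Latin square on n of the N values; \<open>Suc\<close> moves the
    residues 0, ..., n - 1 to 1, ..., n.\<close>
  define P where "P = {(x, y, b). x \<in> {1..n} \<and> y \<in> {1..n} \<and> b = Suc ((x + y) mod n)}"
  have "P \<subseteq> box n N"
  proof
    fix p assume "p \<in> P"
    then obtain x y where p: "p = (x, y, Suc ((x + y) mod n))" "x \<in> {1..n}" "y \<in> {1..n}"
      by (auto simp: P_def)
    then have "(x + y) mod n < n" by auto
    with assms have "Suc ((x + y) mod n) \<le> N" by linarith
    with p show "p \<in> box n N" by (auto simp: box_def)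
  qed
  moreover have "partial_latin P"
    unfolding partial_latin_def
  proof (intro conjI allI impI)
    fix x y b b' assume "(x, y, b) \<in> P" "(x, y, b') \<in> P"
    then show "b = b'" by (simp add: P_def)
  next
    fix x y y' b assume "(x, y, b) \<in> P" "(x, y', b) \<in> P"
    then show "y = y'" using mod_add_left_inj[of y x n y'] by (simp add: P_def add.commute)
  next
    fix x x' y b assume "(x, y, b) \<in> P" "(x', y, b) \<in> P"
    then show "x = x'" using mod_add_left_inj[of x y n x'] by (simp add: P_def)
  qed
  moreover have "\<exists>b. (x, y, b) \<in> P" if "x \<in> {1..n}" "y \<in> {1..n}" for x y
    using that by (auto simp: P_def)
  ultimately show thesis
    using that assms linjection_indicator by metis
qed

section \<open>Completing partial Latin sets when N \<ge> 2n - 1\<close>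

lemma partial_latin_insert:
  assumes P: "P \<subseteq> box n N" "partial_latin P" and N: "N \<ge> 2 * n - 1"
    and xy: "x \<in> {1..n}" "y \<in> {1..n}" and empty: "\<And>b. (x, y, b) \<notin> P"
  obtains b where "b \<in> {1..N}" "partial_latin (insert (x, y, b) P)"
proof -
  \<comment> \<open>\<open>R\<close> and \<open>C\<close> are the values already used in row
    \<open>x\<close> and in column \<open>y\<close>, the ones that the empty cell must
    avoid.\<close>
  define R where "R = {b. \<exists>y'. (x, y', b) \<in> P}"
  define C where "C = {b. \<exists>x'. (x', y, b) \<in> P}"
  \<comment> \<open>Each filled cell determines its value, so \<open>R\<close> and \<open>C\<close>
    are covered by images of the n - 1 other cells of the row or column.\<close>
  have the_val: "(THE b. (u, v, b) \<in> P) = c" if "(u, v, c) \<in> P" for u v c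
    using that P(2) unfolding partial_latin_def by (metis the_equality)
  have R: "R \<subseteq> (\<lambda>y'. THE b. (x, y', b) \<in> P) ` ({1..n} - {y})"
  proof
    fix b assume "b \<in> R"
    then obtain y' where y': "(x, y', b) \<in> P" by (auto simp: R_def)
    then have "b = (THE b. (x, y', b) \<in> P)"
      using the_val by simp
    moreover have "y' \<in> {1..n} - {y}"
      using y' empty P(1) by (auto simp: box_def)
    ultimately show "b \<in> (\<lambda>y'. THE b. (x, y', b) \<in> P) ` ({1..n} - {y})" by (rule image_eqI)
  qed
  have C: "C \<subseteq> (\<lambda>x'. THE b. (x', y, b) \<in> P) ` ({1..n} - {x})"
  proof
    fix b assume "b \<in> C"
    then obtain x' where x': "(x', y, b) \<in> P" by (auto simp: C_def)
    then have "b = (THE b. (x', y, b) \<in> P)"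
      using the_val by simp
    moreover have "x' \<in> {1..n} - {x}"
      using x' empty P(1) by (auto simp: box_def)
    ultimately show "b \<in> (\<lambda>x'. THE b. (x', y, b) \<in> P) ` ({1..n} - {x})" by (rule image_eqI)
  qed
  have "card R \<le> n - 1" "card C \<le> n - 1"
    using surj_card_le[OF _ R] surj_card_le[OF _ C] xy by auto
  then have "card (R \<union> C) \<le> (n - 1) + (n - 1)"
    using card_Un_le[of R C] by linarith
  \<comment> \<open>The membership facts \<open>xy\<close> give n \<ge> 1, so truncated subtraction
    is harmless and 2n - 2 < 2n - 1 \<le> N.\<close>
  moreover have "(n - 1) + (n - 1) < N"
    using N xy by auto
  ultimately have "card (R \<union> C) < card {1..N}"
    by simp
  moreover have "finite (R \<union> C)"
    using R C finite_subset by (metis finite_Diff finite_UnI finite_atLeastAtMost finite_imageI)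
  ultimately have "\<not> {1..N} \<subseteq> R \<union> C"
    using card_mono[of "R \<union> C" "{1..N}"] by linarith
  then obtain b where "b \<in> {1..N}" "b \<notin> R \<union> C"
    by blast
  moreover from this have "partial_latin (insert (x, y, b) P)"
    using P(2) empty unfolding partial_latin_def R_def C_def by blast
  ultimately show thesis using that by blast
qed

text \<open>An inclusion-maximal partial Latin set above \<open>P\<close> has no empty cell, since
  an empty one could still be filled.\<close>

lemma partial_latin_complete:
  assumes P: "P \<subseteq> box n N" "partial_latin P" and N: "N \<ge> 2 * n - 1"
  obtains Q where "P \<subseteq> Q" "Q \<subseteq> box n N" "partial_latin Q"
    "\<And>x y. x \<in> {1..n} \<Longrightarrow> y \<in> {1..n} \<Longrightarrow> \<exists>b. (x, y, b) \<in> Q"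
proof -
  let ?S = "{Q. P \<subseteq> Q \<and> Q \<subseteq> box n N \<and> partial_latin Q}"
  have "?S \<subseteq> Pow (box n N)"
    by blast
  then have "finite ?S"
    by (rule finite_subset) (simp add: finite_box)
  moreover have "?S \<noteq> {}"
    using P by blast
  ultimately obtain Q where Q: "Q \<in> ?S" and max: "\<forall>Q' \<in> ?S. Q \<subseteq> Q' \<longrightarrow> Q = Q'"
    by (metis (no_types, lifting) finite_has_maximal)
  have PQ: "P \<subseteq> Q" and Qbox: "Q \<subseteq> box n N" and latin: "partial_latin Q"
    using Q by simp_all
  have "\<exists>b. (x, y, b) \<in> Q" if xy: "x \<in> {1..n}" "y \<in> {1..n}" for x y
  proof (rule ccontr)
    assume neg: "\<nexists>b. (x, y, b) \<in> Q"
    then obtain b where b: "b \<in> {1..N}" "partial_latin (insert (x, y, b) Q)"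
      using partial_latin_insert[OF Qbox latin N xy] by metis
    have "(x, y, b) \<in> box n N"
      using xy b(1) by (simp add: box_def)
    then have "insert (x, y, b) Q \<in> ?S"
      using b(2) PQ Qbox by blast
    then have "Q = insert (x, y, b) Q"
      using max by (meson subset_insertI)
    with neg show False by blast
  qed
  then show thesis
    by (rule that[OF PQ Qbox latin])
qed

section \<open>The two inequalities between the maxima\<close>

theorem theorem14:
  fixes n N :: nat
  assumes "n > 0" and "N > 0"
  shows "(n \<le> N \<longrightarrow> alpha3 n N \<le> alpha_bar n N) \<and>
         (N \<ge> 2 * n - 1 \<longrightarrow> alpha3 n N = alpha_bar n N)"
proof -
  have le: "alpha3 n N \<le> alpha_bar n N" if nN: "n \<le> N"
  proof -
    obtain g where "linjection n N g" using linjection_exists[OF nN] .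
    then obtain f C where C: "linjection n N f" "cylinder_intersection n N C"
      "C \<subseteq> {p \<in> box n N. f p = 1}" "card C = alpha3 n N"
      by (rule alpha3_attained)
    have box: "C \<subseteq> box n N"
      by (rule cylinder_intersection_subset[OF C(2)])
    moreover have "partial_latin C"
      by (rule partial_latin_subset[OF linjection_partial_latin[OF C(1)] C(3)])
    moreover have "star_closed C"
      using C(2) cylinder_intersection_iff[OF box] by simp
    ultimately show ?thesis
      using alpha_bar_ge C(4) by metis
  qed
  have ge: "alpha_bar n N \<le> alpha3 n N" if N: "N \<ge> 2 * n - 1"
  proof -
    obtain P where P: "P \<subseteq> box n N" "partial_latin P" "star_closed P" "card P = alpha_bar n N"
      by (rule alpha_bar_attained)
    obtain Q where Q: "P \<subseteq> Q" "Q \<subseteq> box n N" "partial_latin Q"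
      "\<And>x y. x \<in> {1..n} \<Longrightarrow> y \<in> {1..n} \<Longrightarrow> \<exists>b. (x, y, b) \<in> Q"
      using partial_latin_complete[OF P(1,2) N] by metis
    have "n \<le> N" using N assms by simp
    then obtain f where f: "linjection n N f" "{p \<in> box n N. f p = 1} = Q"
      using Q(4) by (rule linjection_indicator[OF Q(2,3)])
    \<comment> \<open>The cylinder intersection is the original \<open>P\<close>, contained in the
      set \<open>Q\<close> where \<open>f\<close> equals 1.\<close>
    have "cylinder_intersection n N P"
      using P(3) cylinder_intersection_iff[OF P(1)] by simp
    then show ?thesis
      using alpha3_ge[OF f(1)] P(4) Q(1) f(2) by metis
  qed
  show ?thesis
  proof (intro conjI impI)
    assume N: "N \<ge> 2 * n - 1"
    then have "n \<le> N" using assms by simp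
    then show "alpha3 n N = alpha_bar n N"
      using le ge[OF N] by (meson le_antisym)
  qed (rule le)
qed

end
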